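(* If $X$ is a $T_0$ quasi-developable topological space, then $\operatorname{ps}(X)=\log(|X|)$.
   Context: A countable collection $\mathbb U$ of families of open sets of a space $X$ is a quasi-development if for every $x\in X$ the nonempty members of $\{\operatorname{St}(x,\mathcal U):\mathcal U\in\mathbb U\}$ form a local base at $x$, where $\operatorname{St}(x,\mathcal U)=\bigcup\{U\in\mathcal U:x\in U\}$ (the families $\mathcal U$ are not required to cover $X$). A space is quasi-developable if it admits a quasi-development. Point separating game $G_\beta(X)$ ($X$ a topological space, $\beta$ an ordinal): two players, Seeker and Hider, make $\beta$ moves. At move $\alpha<\beta$, knowing all previous moves, the Seeker chooses an open set $U_\alpha\subseteq X$, and then the Hider chooses $V_\alpha\in\{U_\alpha, X\setminus U_\alpha\}$. The outcome is $W=\bigcap_{\alpha<\beta}V_\alpha$ (with $W=X$ if $\beta=0$). The Seeker wins iff $|W|\le 1$. For a $T_0$ space $X$, $\operatorname{ps}(X)$ is the least ordinal $\beta$ such that the Seeker has a winning strategy in $G_\beta(X)$. For a cardinal $\kappa$, $\log(\kappa)=\min\{\lambda:2^\lambda\ge\kappa\}$ (minimum over cardinals). *)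

theory Defs
  imports "HOL-Analysis.Analysis"
begin

unbundle cardinal_syntax

definition star :: "'a \<Rightarrow> 'a set set \<Rightarrow> 'a set" where
  "star x \<U> = \<Union>{U \<in> \<U>. x \<in> U}"

definition local_base_at :: "'a topology \<Rightarrow> 'a \<Rightarrow> 'a set set \<Rightarrow> bool" where
  "local_base_at X x \<B> \<longleftrightarrow>
     (\<forall>B\<in>\<B>. openin X B \<and> x \<in> B) \<and>
     (\<forall>W. openin X W \<and> x \<in> W \<longrightarrow> (\<exists>B\<in>\<B>. B \<subseteq> W))"

definition quasi_development :: "'a topology \<Rightarrow> 'a set set set \<Rightarrow> bool" where
  "quasi_development X D \<longleftrightarrow>
     countable D \<and>
     (\<forall>\<U>\<in>D. \<forall>U\<in>\<U>. openin X U) \<and>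
     (\<forall>x\<in>topspace X. local_base_at X x {S. S \<in> star x ` D \<and> S \<noteq> {}})"

definition quasi_developable_space :: "'a topology \<Rightarrow> bool" where
  "quasi_developable_space X \<longleftrightarrow> (\<exists>D. quasi_development X D)"

text \<open>
  An ordinal is represented by a (reflexive) well-order relation \<open>\<beta>\<close> of that order type; the
  moves of the game of length \<open>\<beta>\<close> are indexed by \<open>Field \<beta>\<close>, and \<open>underS \<beta> a\<close> is the set of
  moves preceding \<open>a\<close>. A Seeker strategy maps a move \<open>a\<close> and a history to the set played by
  the Seeker at \<open>a\<close>; the history records the pairs (Seeker's set, Hider's set) of all moves
  before \<open>a\<close>, and nothing else because of \<open>restrict\<close>.
\<close>

type_synonym ('i, 'a) strategy = "'i \<Rightarrow> ('i \<Rightarrow> 'a set \<times> 'a set) \<Rightarrow> 'a set"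

definition seeker_strategy :: "'a topology \<Rightarrow> 'i rel \<Rightarrow> ('i, 'a) strategy \<Rightarrow> bool" where
  "seeker_strategy X \<beta> \<sigma> \<longleftrightarrow> (\<forall>a\<in>Field \<beta>. \<forall>h. openin X (\<sigma> a h))"

definition play_with ::
    "'a topology \<Rightarrow> 'i rel \<Rightarrow> ('i, 'a) strategy \<Rightarrow> ('i \<Rightarrow> 'a set) \<Rightarrow> ('i \<Rightarrow> 'a set) \<Rightarrow> bool" where
  "play_with X \<beta> \<sigma> U V \<longleftrightarrow>
     (\<forall>a\<in>Field \<beta>.
        U a = \<sigma> a (restrict (\<lambda>b. (U b, V b)) (underS \<beta> a)) \<and>
        V a \<in> {U a, topspace X - U a})"

definition outcome :: "'a topology \<Rightarrow> 'i rel \<Rightarrow> ('i \<Rightarrow> 'a set) \<Rightarrow> 'a set" where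
  "outcome X \<beta> V = topspace X \<inter> (\<Inter>a\<in>Field \<beta>. V a)"

definition seeker_wins :: "'a topology \<Rightarrow> 'i rel \<Rightarrow> bool" where
  "seeker_wins X \<beta> \<longleftrightarrow>
     (\<exists>\<sigma>. seeker_strategy X \<beta> \<sigma> \<and>
        (\<forall>U V. play_with X \<beta> \<sigma> U V \<longrightarrow>
           finite (outcome X \<beta> V) \<and> card (outcome X \<beta> V) \<le> 1))"

text \<open>
  \<open>is_ps X \<beta>\<close>: the ordinal \<open>\<beta>\<close> is \<open>ps(X)\<close>; \<open>is_log \<kappa> \<mu>\<close>: the cardinal \<open>\<mu>\<close> is \<open>log(\<kappa>)\<close>.
  In both definitions the competitors range over relations on the same type \<open>'i\<close> as the
  candidate. This is no restriction: any ordinal or cardinal smaller than the candidate, on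
  whatever type, is isomorphic to an initial segment of it and hence to a relation on \<open>'i\<close>.
\<close>

definition is_ps :: "'a topology \<Rightarrow> 'i rel \<Rightarrow> bool" where
  "is_ps X \<beta> \<longleftrightarrow>
     Well_order \<beta> \<and> seeker_wins X \<beta> \<and>
     (\<forall>\<gamma> :: 'i rel. Well_order \<gamma> \<and> seeker_wins X \<gamma> \<longrightarrow> \<beta> \<le>o \<gamma>)"

definition is_log :: "'k rel \<Rightarrow> 'i rel \<Rightarrow> bool" where
  "is_log \<kappa> \<mu> \<longleftrightarrow>
     Card_order \<mu> \<and> \<kappa> \<le>o ctwo ^c \<mu> \<and>
     (\<forall>\<nu> :: 'i rel. Card_order \<nu> \<and> \<kappa> \<le>o ctwo ^c \<nu> \<longrightarrow> \<mu> \<le>o \<nu>)"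

end

theory Submission
  imports Defs
begin

text \<open>
  If the Hider always keeps a fixed point \<open>x\<close>, the Hider's answers determine \<open>x\<close>; hence a Seeker
  winning in \<open>\<beta>\<close> moves gives an injection of the space into the power set of \<open>\<beta>\<close>, and
  \<open>log |X| \<le> \<beta>\<close>. Conversely, put \<open>\<mu> = log |X|\<close>. If \<open>\<mu>\<close> is finite, the Seeker halves the set of
  remaining points at each move, which is possible because a finite \<open>T\<^sub>0\<close> space has open sets of
  every size. If \<open>\<mu>\<close> is infinite, there are \<open>\<mu>\<close> open sets separating the points, which the Seeker
  plays in any order: for a member \<open>\<U>\<close> of the quasi-development let \<open>f x\<close> be the first
  \<open>U \<in> \<U>\<close> with \<open>x \<in> U\<close>. For another member \<open>\<V>\<close>, the set \<open>F\<close> of the points \<open>x\<close> with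
  \<open>star x \<V> \<subseteq> f x\<close> splits into the fibres of \<open>f\<close>, and no member of \<open>\<V>\<close> meets two of them. The
  values of \<open>f\<close> can be coded by subsets of \<open>\<mu>\<close>, and the neighbourhoods of \<open>F\<close> made of members of
  \<open>\<V>\<close> can be cut according to the bits of the code; points outside the closure of \<open>F\<close> are separated
  from \<open>F\<close> by \<open>\<Union>\<V>\<close> and by \<open>\<Union>\<V>\<close> minus that closure.
\<close>

section \<open>Lower bound: a Hider who protects a point\<close>

lemma follow_point_play:
  fixes X :: "'a topology" and r :: "'i rel"
  assumes r: "Well_order r"
    and x: "x \<in> topspace X"
  shows "\<exists>U V. play_with X r \<sigma> U V \<and> (\<forall>a. V a = (if x \<in> U a then U a else topspace X - U a))"
proof -
  interpret wo_rel r
    using r by (simp add: wo_rel_def)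
  \<comment> \<open>Once the protected point is fixed, the Seeker's set determines the answer, so
    the whole play is a well-founded recursion along \<open>r\<close> with pairs of sets as
    values.\<close>
  define H :: "('i \<Rightarrow> 'a set \<times> 'a set) \<Rightarrow> 'i \<Rightarrow> 'a set \<times> 'a set" where
    "H f a = (let u = \<sigma> a (restrict f (underS a))
              in (u, if x \<in> u then u else topspace X - u))" for f a
  have "adm_wo H"
    unfolding adm_wo_def
  proof (intro allI impI)
    fix f g :: "'i \<Rightarrow> 'a set \<times> 'a set" and a
    assume "\<forall>y\<in>underS a. f y = g y"
    then have "restrict f (underS a) = restrict g (underS a)"
      by (auto simp: restrict_def)
    then show "H f a = H g a"
      by (simp add: H_def)
  qed
  then have P: "worec H = H (worec H)"
    by (rule worec_fixpoint)
  define P where "P = worec H"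
  have Peq: "P a = H P a" for a
    using P unfolding P_def by metis
  define U where "U = fst \<circ> P"
  define V where "V = snd \<circ> P"
  have UV: "(\<lambda>b. (U b, V b)) = P"
    by (simp add: U_def V_def fun_eq_iff)
  have U: "U a = \<sigma> a (restrict P (underS a))" for a
    unfolding U_def comp_def by (subst Peq) (simp add: H_def Let_def)
  have V: "V a = (if x \<in> U a then U a else topspace X - U a)" for a
    unfolding U_def V_def comp_def
    by (subst (1 2 3 4) Peq) (simp add: H_def Let_def)
  have "play_with X r \<sigma> U V"
    unfolding play_with_def UV using U V by auto
  then show ?thesis
    using V by blast
qed

text \<open>Let \<open>c x\<close> record the moves at which the protected point \<open>x\<close>
  lies in the Seeker's set. By induction on the moves, points with equal codes produce the same
  play; both survive it, so a winning strategy forces them to be equal.\<close>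

lemma seeker_wins_card_le:
  fixes X :: "'a topology"
  assumes r: "Well_order r"
    and win: "seeker_wins X r"
  shows "|topspace X| \<le>o |Pow (Field r)|"
proof -
  interpret wo_rel r
    using r by (simp add: wo_rel_def)
  obtain \<sigma> where \<sigma>: "\<And>U V. play_with X r \<sigma> U V \<Longrightarrow>
      finite (outcome X r V) \<and> card (outcome X r V) \<le> 1"
    using win unfolding seeker_wins_def by blast
  obtain U V where UV: "\<And>x. x \<in> topspace X \<Longrightarrow> play_with X r \<sigma> (U x) (V x)"
    and V: "\<And>x a. x \<in> topspace X \<Longrightarrow>
        V x a = (if x \<in> U x a then U x a else topspace X - U x a)"
    using follow_point_play[OF r, of _ X \<sigma>] by metis
  define c where "c x = {a \<in> Field r. x \<in> U x a}" for x
  have "inj_on c (topspace X)"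
  proof (rule inj_onI)
    fix x y assume x: "x \<in> topspace X" and y: "y \<in> topspace X" and eq: "c x = c y"
    have same: "a \<in> Field r \<longrightarrow> U x a = U y a \<and> V x a = V y a" for a
    proof (induction a rule: well_order_induct)
      case (1 a)
      show ?case
      proof
        assume a: "a \<in> Field r"
        have "restrict (\<lambda>b. (U x b, V x b)) (underS a) = restrict (\<lambda>b. (U y b, V y b)) (underS a)"
          using 1 by (fastforce simp: underS_def intro: FieldI1)
        then have "U x a = U y a"
          using UV[OF x] UV[OF y] a unfolding play_with_def by metis
        moreover have "x \<in> U x a \<longleftrightarrow> y \<in> U y a"
          using eq a by (auto simp: c_def)
        ultimately show "U x a = U y a \<and> V x a = V y a"
          using V x y by simp
      qed
    qed
    have "x \<in> outcome X r (V x)"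
      using x V by (auto simp: outcome_def)
    moreover have "y \<in> outcome X r (V x)"
      using y V same by (auto simp: outcome_def)
    ultimately show "x = y"
      using \<sigma>[OF UV[OF x]] by (metis card_le_Suc0_iff_eq One_nat_def)
  qed
  moreover have "c ` topspace X \<subseteq> Pow (Field r)"
    by (auto simp: c_def)
  ultimately show ?thesis
    using card_of_ordLeq by blast
qed

section \<open>Finite spaces: halving the remaining points\<close>

lemma t0_space_finite_subset_open_remove_point:
  assumes X: "t0_space X"
    and W: "finite W" "W \<subseteq> topspace X" "W \<noteq> {}"
  shows "\<exists>U x. openin X U \<and> x \<in> W \<and> U \<inter> W = W - {x}"
proof -
  \<comment> \<open>A maximal proper trace on \<open>W\<close> misses only one point: if it missed
    two, an open set containing exactly one of them could be added, giving a larger proper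
    trace.\<close>
  let ?S = "{A. \<exists>U. openin X U \<and> A = U \<inter> W \<and> A \<noteq> W}"
  have "finite ?S"
    by (rule finite_subset[of _ "Pow W"]) (use W in auto)
  moreover have "{} \<in> ?S"
    using W by (auto intro!: exI[of _ "{}"])
  ultimately obtain A where "A \<in> ?S" and max: "\<And>B. B \<in> ?S \<Longrightarrow> A \<subseteq> B \<Longrightarrow> A = B"
    using finite_has_maximal[of ?S] by (metis (no_types, lifting) empty_iff)
  then obtain U where U: "openin X U" "A = U \<inter> W" "A \<noteq> W"
    by auto
  then obtain x where x: "x \<in> W" "x \<notin> U"
    by auto
  have "y = x" if y: "y \<in> W" "y \<notin> U" for y
  proof (rule ccontr)
    assume "y \<noteq> x"
    then obtain G where G: "openin X G" "x \<notin> G \<longleftrightarrow> y \<in> G"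
      using X x y W unfolding t0_space_def by (metis subsetD)
    have "(U \<union> G) \<inter> W \<in> ?S"
      using U(1) G x y by (auto intro!: exI[of _ "U \<union> G"])
    then have "A = (U \<union> G) \<inter> W"
      by (rule max) (use U in auto)
    then show False
      using U G x y by auto
  qed
  then have "U \<inter> W = W - {x}"
    using x by blast
  then show ?thesis
    using U x by metis
qed

text \<open>Points are removed one at a time. Intersecting with \<open>U\<close>, whose trace is
  \<open>W - {x}\<close>, keeps the removed point \<open>x\<close> out of the set found for the
  smaller trace.\<close>

lemma t0_space_open_of_card:
  assumes X: "t0_space X"
    and "finite W" "W \<subseteq> topspace X" "j \<le> card W"
  shows "\<exists>U. openin X U \<and> card (U \<inter> W) = j"
  using assms(2-)
proof (induction "card W" arbitrary: W)
  case 0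
  then show ?case
    by (auto intro!: exI[of _ "{}"])
next
  case (Suc n)
  show ?case
  proof (cases "j = card W")
    case True
    then show ?thesis
      using Suc.prems by (intro exI[of _ "topspace X"]) (auto simp: Int_absorb1)
  next
    case False
    obtain U x where U: "openin X U" "x \<in> W" "U \<inter> W = W - {x}"
      using t0_space_finite_subset_open_remove_point[OF X Suc.prems(1,2)] Suc.hyps(2) by force
    have "card (W - {x}) = n"
      using U Suc by simp
    then obtain G where G: "openin X G" "card (G \<inter> (W - {x})) = j"
      using Suc.hyps(1)[of "W - {x}"] Suc.prems Suc.hyps(2) False by fastforce
    moreover have "(G \<inter> U) \<inter> W = G \<inter> (W - {x})"
      using U by blast
    ultimately show ?thesis
      using U by (metis openin_Int)
  qed
qed

lemma seeker_wins_finite: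
  fixes X :: "'a topology" and r :: "'i rel"
  assumes X: "t0_space X"
    and fin: "finite (topspace X)"
    and r: "Well_order r" "finite (Field r)"
    and le: "card (topspace X) \<le> 2 ^ card (Field r)"
  shows "seeker_wins X r"
proof -
  interpret wo_rel r
    using r by (simp add: wo_rel_def)
  define rem where "rem V A = topspace X \<inter> (\<Inter>b\<in>A. V b)" for V :: "'i \<Rightarrow> 'a set" and A
  have fin_rem: "finite (rem V A)" for V A
    using fin by (simp add: rem_def)
  have "\<forall>W. \<exists>U. openin X U \<and> (W \<subseteq> topspace X \<longrightarrow> card (U \<inter> W) = card W div 2)"
  proof
    fix W
    show "\<exists>U. openin X U \<and> (W \<subseteq> topspace X \<longrightarrow> card (U \<inter> W) = card W div 2)"
    proof (cases "W \<subseteq> topspace X")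
      case True
      then show ?thesis
        using t0_space_open_of_card[OF X, of W "card W div 2"] fin finite_subset by force
    qed blast
  qed
  then obtain h where h_open: "\<And>W. openin X (h W)"
    and h: "\<And>W. W \<subseteq> topspace X \<Longrightarrow> card (h W \<inter> W) = card W div 2"
    by metis
  define \<sigma> :: "('i, 'a) strategy" where
    "\<sigma> a H = h (rem (snd \<circ> H) (underS a))" for a H
  have "card (outcome X r V) \<le> 1" if play: "play_with X r \<sigma> U V" for U V
  proof -
    \<comment> \<open>The invariant for initial segments \<open>A\<close> of the moves: at most 2 to
      the number of moves left points remain. For \<open>A = Field r\<close> this leaves at most one
      point.\<close>
    have "card (rem V A) \<le> 2 ^ card (Field r - A)"
      if "A \<subseteq> Field r" "\<And>a. a \<in> A \<Longrightarrow> underS a \<subseteq> A" for A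
      using that
    proof (induction "card A" arbitrary: A)
      case 0
      then have "A = {}"
        using r finite_subset by fastforce
      then show ?case
        using le by (simp add: rem_def)
    next
      case (Suc n)
      have finA: "finite A"
        using Suc.prems r finite_subset by blast
      have "A \<noteq> {}"
        using Suc.hyps by auto
      then obtain a where a: "a \<in> A" "\<And>b. b \<in> A \<Longrightarrow> (b, a) \<in> r"
        using Suc.prems(1) finA
      proof -
        \<comment> \<open>The last move of \<open>A\<close> is the one with the most
          predecessors.\<close>
        have "Max ((\<lambda>b. card (underS b)) ` A) \<in> (\<lambda>b. card (underS b)) ` A"
          using finA \<open>A \<noteq> {}\<close> by (intro Max_in) auto
        then obtain a where "a \<in> A" "Max ((\<lambda>b. card (underS b)) ` A) = card (underS a)"
          by (rule imageE)
        then have a: "a \<in> A" "\<forall>b\<in>A. card (underS b) \<le> card (underS a)"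
          using finA by (metis, metis Max_ge finite_imageI imageI)
        have "(b, a) \<in> r" if b: "b \<in> A" for b
        proof (rule ccontr)
          assume n: "(b, a) \<notin> r"
          then have ab: "(a, b) \<in> r" "a \<noteq> b"
            using TOTALS REFL a(1) b Suc.prems(1) by (blast, metis in_mono refl_on_def)
          then have "underS a \<subset> underS b"
            using TRANS ANTISYM unfolding underS_def trans_def antisym_def by blast
          moreover have "finite (underS b)"
            using b Suc.prems(2) finA finite_subset by blast
          ultimately show False
            using a(2) b psubset_card_mono by (metis leD)
        qed
        with a(1) show ?thesis
          using that by blast
      qed
      have A: "underS a = A - {a}"
        using a Suc.prems(2) by (auto simp: underS_def)
      have aF: "a \<in> Field r"
        using a Suc.prems by blast
      let ?W = "rem V (underS a)"
      have IH: "card ?W \<le> 2 ^ card (Field r - underS a)"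
      proof (rule Suc.hyps(1))
        show "n = card (underS a)"
          using A a Suc.hyps(2) finA by simp
        show "underS a \<subseteq> Field r"
          using A Suc.prems by blast
        show "underS b \<subseteq> underS a" if "b \<in> underS a" for b
          using that TRANS ANTISYM unfolding underS_def trans_def antisym_def by blast
      qed
      have "Field r - underS a = insert a (Field r - A)"
        using A a aF by blast
      then have card: "card (Field r - underS a) = Suc (card (Field r - A))"
        using r a by simp
      have "rem (snd \<circ> restrict (\<lambda>b. (U b, V b)) (underS a)) (underS a) = ?W"
        by (auto simp: rem_def)
      then have Ua: "U a = h ?W" and Va: "V a \<in> {U a, topspace X - U a}"
        using play aF unfolding play_with_def \<sigma>_def by (metis, blast)
      have WA: "rem V A = ?W \<inter> V a"
        using a A by (auto simp: rem_def)
      have half: "card (h ?W \<inter> ?W) = card ?W div 2"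
        by (rule h) (simp add: rem_def)
      have "card (?W - h ?W) = card ?W - card ?W div 2"
        using half card_Diff_subset_Int[of ?W "h ?W"] fin_rem[of V "underS a"]
        by (simp add: Int_commute)
      moreover have "rem V A \<in> {h ?W \<inter> ?W, ?W - h ?W}"
        using Va WA Ua by (auto simp: rem_def)
      \<comment> \<open>The worse answer leaves half of \<open>?W\<close> rounded up. The bound on
        \<open>card ?W\<close> is twice the bound wanted, so the rounding does no harm.\<close>
      ultimately have "card (rem V A) \<le> card ?W - card ?W div 2"
        using half by auto
      then show ?case
        using IH card by simp
    qed
    moreover have "underS a \<subseteq> Field r" for a
      by (auto simp: underS_Field)
    ultimately have "card (rem V (Field r)) \<le> 2 ^ card (Field r - Field r)"
      by blast
    then show ?thesis
      by (simp add: outcome_def rem_def)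
  qed
  moreover have "finite (outcome X r V)" for V
    using fin by (simp add: outcome_def)
  moreover have "seeker_strategy X r \<sigma>"
    using h_open by (simp add: seeker_strategy_def \<sigma>_def)
  ultimately show ?thesis
    unfolding seeker_wins_def by blast
qed

section \<open>Infinite length: small separating families\<close>

lemma seeker_wins_separating_family:
  fixes X :: "'a topology" and r :: "'i rel"
  assumes S_open: "\<And>U. U \<in> S \<Longrightarrow> openin X U"
    and le: "|S| \<le>o |Field r|"
    and sep: "\<And>x y. x \<in> topspace X \<Longrightarrow> y \<in> topspace X \<Longrightarrow> x \<noteq> y \<Longrightarrow>
        \<exists>U\<in>S. x \<in> U \<longleftrightarrow> y \<notin> U"
  shows "seeker_wins X r"
proof -
  obtain j where j: "inj_on j S" "j ` S \<subseteq> Field r"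
    using le card_of_ordLeq by metis
  \<comment> \<open>By injectivity of \<open>j\<close> the union has at most one term; at moves
    outside the range of \<open>j\<close> the Seeker plays the empty set.\<close>
  define \<sigma> where "\<sigma> a h = \<Union>{U \<in> S. j U = a}" for a and h :: "'i \<Rightarrow> 'a set \<times> 'a set"
  have "x = y"
    if play: "play_with X r \<sigma> U V" and x: "x \<in> outcome X r V" and y: "y \<in> outcome X r V"
    for U V x y
  proof (rule ccontr)
    assume "x \<noteq> y"
    then obtain G where G: "G \<in> S" "x \<in> G \<longleftrightarrow> y \<notin> G"
      using sep[of x y] x y by (auto simp: outcome_def)
    have "{U \<in> S. j U = j G} = {G}"
      using j G by (auto dest: inj_onD)
    then have "\<sigma> (j G) h = G" for h
      by (simp add: \<sigma>_def)
    moreover have "j G \<in> Field r"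
      using j G by blast
    ultimately have "V (j G) \<in> {G, topspace X - G}"
      using play unfolding play_with_def by metis
    then show False
      using x y G \<open>j G \<in> Field r\<close> by (auto simp: outcome_def)
  qed
  then have "finite (outcome X r V) \<and> card (outcome X r V) \<le> 1" if "play_with X r \<sigma> U V" for U V
    using that finite_subset[of "outcome X r V" "{SOME x. x \<in> outcome X r V}"]
    by (metis (no_types, lifting) One_nat_def card_le_Suc0_iff_eq finite.emptyI finite.insertI
        insert_iff someI_ex subsetI)
  moreover have "seeker_strategy X r \<sigma>"
    unfolding seeker_strategy_def \<sigma>_def using S_open by blast
  ultimately show ?thesis
    unfolding seeker_wins_def by blast
qed

text \<open>Let \<open>f x\<close> be the first member of \<open>\<U>\<close> containing
  \<open>x\<close> in a well-order of all sets. If \<open>x \<in> f y\<close> and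
  \<open>y \<in> f x\<close>, each value competes in the minimum defining the other, so they
  coincide.\<close>

lemma first_member_function:
  "\<exists>f. \<forall>x\<in>\<Union>\<U>. f x \<in> \<U> \<and> x \<in> f x \<and> (\<forall>y\<in>\<Union>\<U>. x \<in> f y \<and> y \<in> f x \<longrightarrow> f x = f y)"
proof -
  obtain r :: "'a set rel" where r: "Well_order r" "Field r = UNIV"
    using well_order_on[of UNIV] well_order_on_Well_order by blast
  interpret wo_rel r
    using r by (simp add: wo_rel_def)
  define f where "f x = minim {U \<in> \<U>. x \<in> U}" for x
  have f: "f x \<in> \<U> \<and> x \<in> f x" if "x \<in> \<Union>\<U>" for x
    using minim_in[of "{U \<in> \<U>. x \<in> U}"] that r by (auto simp: f_def)
  moreover have "(f x, U) \<in> r" if "U \<in> \<U>" "x \<in> U" for x U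
    unfolding f_def using minim_least[of "{U \<in> \<U>. x \<in> U}" U] that r by auto
  ultimately show ?thesis
    using ANTISYM unfolding antisym_def by (intro exI[of _ f]) blast
qed

text \<open>Two points of \<open>F\<close> in a common member of \<open>\<V>\<close> lie in each
  other's value of \<open>f\<close>, so these values agree. If \<open>y\<close> is in the closure of
  \<open>F\<close> and in some \<open>V \<in> \<V>\<close>, then \<open>V\<close> contains some
  \<open>z \<in> F\<close> and \<open>y \<in> f z\<close>. As \<open>y \<notin> f x\<close>, the
  codes of \<open>f x\<close> and \<open>f z\<close> differ in a bit \<open>i\<close>, and
  \<open>G i\<close> separates \<open>x\<close> from \<open>y\<close>. The other two sets of
  \<open>S\<close> serve every other \<open>y\<close>.\<close>

lemma separating_family_pair:
  fixes X :: "'a topology" and I :: "'i set"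
  assumes V_open: "\<And>V. V \<in> \<V> \<Longrightarrow> openin X V"
    and f_mem: "\<And>x. x \<in> A \<Longrightarrow> x \<in> f x"
    and f_eq: "\<And>x y. x \<in> A \<Longrightarrow> y \<in> A \<Longrightarrow> x \<in> f y \<Longrightarrow> y \<in> f x \<Longrightarrow> f x = f y"
    and A: "|A| \<le>o |Pow I|"
    and I: "infinite I"
  shows "\<exists>S. (\<forall>K\<in>S. openin X K) \<and> |S| \<le>o |I| \<and>
    (\<forall>x\<in>A \<inter> \<Union>\<V>. \<forall>y. star x \<V> \<subseteq> f x \<and> y \<notin> f x \<longrightarrow> (\<exists>K\<in>S. x \<in> K \<longleftrightarrow> y \<notin> K))"
proof -
  define F where "F = {x \<in> A \<inter> \<Union>\<V>. star x \<V> \<subseteq> f x}"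
  have f_F: "f x = f z" if "x \<in> F" "z \<in> F" "V \<in> \<V>" "x \<in> V" "z \<in> V" for x z V
    using that f_eq[of x z] unfolding F_def star_def by blast
  have "|f ` A| \<le>o |Pow I|"
    using card_of_image A ordLeq_transitive by blast
  then obtain s where s: "inj_on s (f ` A)" "s ` f ` A \<subseteq> Pow I"
    using card_of_ordLeq by metis
  define G where "G i = \<Union>{V \<in> \<V>. \<exists>z\<in>F \<inter> V. i \<in> s (f z)}" for i
  define S where "S = {\<Union>\<V>, \<Union>\<V> - X closure_of F} \<union> G ` I"
  have "\<forall>K\<in>S. openin X K"
    unfolding S_def G_def using V_open by (auto intro!: openin_diff)
  moreover have "|S| \<le>o |I|"
    unfolding S_def
  proof (rule card_of_Un_ordLeq_infinite_Field[of "|I|"])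
    show "|{\<Union>\<V>, \<Union>\<V> - X closure_of F}| \<le>o |I|"
      using I by (simp add: ordLeq3_finite_infinite)
  qed (use I in \<open>simp_all add: Field_card_of card_of_card_order_on card_of_image\<close>)
  moreover have "\<exists>K\<in>S. x \<in> K \<longleftrightarrow> y \<notin> K" if x: "x \<in> F" and y: "y \<notin> f x" for x y
  proof (cases "y \<in> \<Union>\<V> \<and> y \<in> X closure_of F")
    case False
    have "x \<in> \<Union>\<V>"
      using x by (simp add: F_def)
    moreover have "x \<in> X closure_of F"
      using closure_of_subset_Int[of X F] V_open openin_subset \<open>x \<in> \<Union>\<V>\<close> x by fastforce
    ultimately show ?thesis
      using False by (auto simp: S_def)
  next
    case True
    then obtain V where V: "V \<in> \<V>" "y \<in> V"
      by blast
    obtain z where z: "z \<in> F" "z \<in> V"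
      using True V V_open[of V] by (auto simp: in_closure_of)
    have "y \<in> f z"
      using z V unfolding F_def star_def by blast
    then have "f x \<noteq> f z"
      using y by auto
    moreover have "x \<in> A" "z \<in> A"
      using x z by (auto simp: F_def)
    ultimately obtain i where i: "i \<in> s (f x) \<longleftrightarrow> i \<notin> s (f z)"
      using s(1) unfolding inj_on_def by blast
    have "i \<in> I"
      using i s(2) \<open>x \<in> A\<close> \<open>z \<in> A\<close> by blast
    have "y \<in> G i \<longleftrightarrow> i \<in> s (f z)"
    proof
      assume "y \<in> G i"
      then obtain V' z' where V': "V' \<in> \<V>" "y \<in> V'" "z' \<in> F" "z' \<in> V'" "i \<in> s (f z')"
        unfolding G_def by blast
      \<comment> \<open>The bit read off at \<open>y\<close> does not depend on the member of
        \<open>\<V>\<close> chosen: \<open>V \<inter> V'\<close> is a neighbourhood of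
        \<open>y\<close>, so it meets \<open>F\<close> in a point sharing its value with both
        \<open>z\<close> and \<open>z'\<close>.\<close>
      have "openin X (V \<inter> V')"
        using V V' V_open by blast
      then obtain w where "w \<in> F" "w \<in> V" "w \<in> V'"
        using True V V' by (auto simp: in_closure_of)
      then have "f z = f z'"
        using f_F V V' z by metis
      then show "i \<in> s (f z)"
        using V' by simp
    qed (use z V in \<open>auto simp: G_def\<close>)
    moreover have "x \<in> G i \<longleftrightarrow> i \<in> s (f x)"
    proof
      assume "x \<in> G i"
      then show "i \<in> s (f x)"
        unfolding G_def using f_F[OF x] by auto
    next
      assume "i \<in> s (f x)"
      moreover obtain V' where "V' \<in> \<V>" "x \<in> V'"
        using x unfolding F_def by blast
      ultimately show "x \<in> G i"
        unfolding G_def using x by blast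
    qed
    moreover have "G i \<in> S"
      using \<open>i \<in> I\<close> by (simp add: S_def)
    ultimately show ?thesis
      using i by metis
  qed
  ultimately show ?thesis
    by (intro exI[of _ S]) (simp add: F_def)
qed

text \<open>Each pair of members of \<open>D\<close> contributes one family, and countably many
  families of size at most \<open>|I|\<close> have a union of size at most \<open>|I|\<close>. Given
  \<open>x \<in> W\<close> and \<open>y \<notin> W\<close>, a first star inside \<open>W\<close>
  gives \<open>y \<notin> f \<U> x\<close>, and a second star inside \<open>f \<U> x\<close> selects
  the pair.\<close>

lemma quasi_developable_separating_family:
  fixes X :: "'a topology" and I :: "'i set"
  assumes X: "t0_space X" "quasi_developable_space X"
    and card: "|topspace X| \<le>o |Pow I|"
    and I: "infinite I"
  shows "\<exists>S. (\<forall>K\<in>S. openin X K) \<and> |S| \<le>o |I| \<and>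
    (\<forall>x\<in>topspace X. \<forall>y\<in>topspace X. x \<noteq> y \<longrightarrow> (\<exists>K\<in>S. x \<in> K \<longleftrightarrow> y \<notin> K))"
proof -
  obtain D where D: "countable D" "\<And>\<U> U. \<U> \<in> D \<Longrightarrow> U \<in> \<U> \<Longrightarrow> openin X U"
    "\<And>x. x \<in> topspace X \<Longrightarrow> local_base_at X x {S. S \<in> star x ` D \<and> S \<noteq> {}}"
    using X(2) unfolding quasi_developable_space_def quasi_development_def by metis
  have small: "\<exists>\<U>\<in>D. x \<in> \<Union>\<U> \<and> star x \<U> \<subseteq> W" if W: "openin X W" "x \<in> W" for x W
  proof -
    have "x \<in> topspace X"
      using W openin_subset by blast
    then have "\<exists>B\<in>{S. S \<in> star x ` D \<and> S \<noteq> {}}. B \<subseteq> W"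
      using D(3) W unfolding local_base_at_def by meson
    \<comment> \<open>Members of \<open>D\<close> need not cover the space; a nonempty star
      guarantees \<open>x \<in> \<Union>\<U>\<close>.\<close>
    then obtain \<U> where "\<U> \<in> D" "star x \<U> \<noteq> {}" "star x \<U> \<subseteq> W"
      by blast
    then show ?thesis
      unfolding star_def by blast
  qed
  have "\<forall>\<U>. \<exists>f. \<forall>x\<in>\<Union>\<U>. f x \<in> \<U> \<and> x \<in> f x \<and>
      (\<forall>y\<in>\<Union>\<U>. x \<in> f y \<and> y \<in> f x \<longrightarrow> f x = (f y :: 'a set))"
    using first_member_function by blast
  then obtain f where f: "\<And>\<U> x. x \<in> \<Union>\<U> \<Longrightarrow> f \<U> x \<in> \<U> \<and> x \<in> f \<U> x \<and>
      (\<forall>y\<in>\<Union>\<U>. x \<in> f \<U> y \<and> y \<in> f \<U> x \<longrightarrow> f \<U> x = (f \<U> y :: 'a set))"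
    by metis
  define sep where "sep \<U> \<V> S \<longleftrightarrow> (\<forall>K\<in>S. openin X K) \<and> |S| \<le>o |I| \<and>
      (\<forall>x\<in>\<Union>\<U> \<inter> \<Union>\<V>. \<forall>y. star x \<V> \<subseteq> f \<U> x \<and> y \<notin> f \<U> x \<longrightarrow> (\<exists>K\<in>S. x \<in> K \<longleftrightarrow> y \<notin> K))"
    for \<U> \<V> S
  have "\<exists>S. sep \<U> \<V> S" if "\<U> \<in> D" "\<V> \<in> D" for \<U> \<V>
    unfolding sep_def
  proof (rule separating_family_pair)
    have "\<Union>\<U> \<subseteq> topspace X"
      using D(2) that openin_subset by blast
    then show "|\<Union>\<U>| \<le>o |Pow I|"
      by (rule ordLeq_transitive[OF card_of_mono1 card])
    show "openin X V" if "V \<in> \<V>" for V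
      using D(2) \<open>\<V> \<in> D\<close> that .
    show "x \<in> f \<U> x" if "x \<in> \<Union>\<U>" for x
      using f[OF that] by simp
    show "f \<U> x = f \<U> y" if "x \<in> \<Union>\<U>" "y \<in> \<Union>\<U>" "x \<in> f \<U> y" "y \<in> f \<U> x" for x y
      using f[OF that(1)] that(2-4) by blast
  qed (rule I)
  then obtain S where S: "\<And>\<U> \<V>. \<U> \<in> D \<Longrightarrow> \<V> \<in> D \<Longrightarrow> sep \<U> \<V> (S \<U> \<V>)"
    by metis
  define T where "T = (\<Union>p\<in>D \<times> D. S (fst p) (snd p))"
  have "\<forall>K\<in>T. openin X K"
    unfolding T_def using S by (auto simp: sep_def)
  moreover have "|T| \<le>o |I|"
    unfolding T_def
  proof (rule card_of_UNION_ordLeq_infinite[OF I])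
    have "countable (D \<times> D)"
      using D by blast
    then have "|D \<times> D| \<le>o |UNIV :: nat set|"
      unfolding countable_def using card_of_ordLeq[of "D \<times> D" "UNIV :: nat set"] by auto
    then show "|D \<times> D| \<le>o |I|"
      using I infinite_iff_card_of_nat ordLeq_transitive by blast
  qed (use S in \<open>auto simp: sep_def\<close>)
  moreover have one_sided: "\<exists>K\<in>T. x \<in> K \<longleftrightarrow> y \<notin> K"
    if W: "openin X W" "x \<in> W" "y \<notin> W" for x y W
  proof -
    obtain \<U> where U: "\<U> \<in> D" "x \<in> \<Union>\<U>" "star x \<U> \<subseteq> W"
      using small W by blast
    have "f \<U> x \<subseteq> star x \<U>"
      using f[OF U(2)] by (auto simp: star_def)
    then have "y \<notin> f \<U> x"
      using U W by blast
    moreover obtain \<V> where V: "\<V> \<in> D" "x \<in> \<Union>\<V>" "star x \<V> \<subseteq> f \<U> x"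
      using small[of "f \<U> x" x] f[OF U(2)] D(2) U(1) by blast
    ultimately have "\<exists>K\<in>S \<U> \<V>. x \<in> K \<longleftrightarrow> y \<notin> K"
      using S[OF U(1) V(1)] U V unfolding sep_def by blast
    then show ?thesis
      unfolding T_def using U V by auto
  qed
  \<comment> \<open>The condition on \<open>K\<close> is symmetric in the two points, so it does not
    matter which of them the open set from the T0 axiom contains.\<close>
  then have "\<exists>K\<in>T. x \<in> K \<longleftrightarrow> y \<notin> K" if "x \<in> topspace X" "y \<in> topspace X" "x \<noteq> y" for x y
    using X(1) that unfolding t0_space_def by metis
  ultimately show ?thesis
    by blast
qed

section \<open>Power set form of the logarithm and conclusion\<close>

lemma ctwo_cexp_ordIso_Pow: "ctwo ^c r =o |Pow (Field r)|"
  unfolding cexp_def ctwo_def Field_card_of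
  by (rule ordIso_symmetric[OF card_of_Pow_Func])

lemma ordLeq_ctwo_cexp_iff: "\<kappa> \<le>o ctwo ^c r \<longleftrightarrow> \<kappa> \<le>o |Pow (Field r)|"
  by (rule iffI; erule ordLeq_ordIso_trans) (intro ctwo_cexp_ordIso_Pow ordIso_symmetric)+

lemma seeker_wins_log:
  assumes X: "t0_space X" "quasi_developable_space X"
    and r: "Well_order r"
    and le: "|topspace X| \<le>o |Pow (Field r)|"
  shows "seeker_wins X r"
proof (cases "finite (Field r)")
  case True
  have fin: "finite (topspace X)"
    using True le card_of_ordLeq_finite by (metis finite_Pow_iff)
  have "card (topspace X) \<le> card (Pow (Field r))"
    using le True fin by (metis card_of_ordLeq card_inj_on_le finite_Pow_iff)
  then show ?thesis
    using seeker_wins_finite[OF X(1) fin r True] True by (simp add: card_Pow)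
next
  case False
  then show ?thesis
    using quasi_developable_separating_family[OF X le]
    by (metis seeker_wins_separating_family)
qed

theorem theorem6p3:
  fixes X :: "'a topology"
  assumes "t0_space X"
    and "quasi_developable_space X"
  shows "\<exists>(\<beta> :: 'a rel) (\<mu> :: 'a rel). is_ps X \<beta> \<and> is_log |topspace X| \<mu> \<and> \<beta> =o \<mu>"
proof -
  let ?R = "{\<nu> :: 'a rel. Card_order \<nu> \<and> |topspace X| \<le>o ctwo ^c \<nu>}"
  \<comment> \<open>By Cantor's theorem \<open>|topspace X|\<close> is itself a candidate, so a
    least one exists among the relations on \<open>'a\<close>.\<close>
  have "|topspace X| \<in> ?R"
    using card_of_Pow[of "topspace X"]
    by (simp add: ordLeq_ctwo_cexp_iff Field_card_of card_of_card_order_on ordLess_imp_ordLeq)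
  then obtain \<mu> where "\<mu> \<in> ?R" and min: "\<forall>\<nu>\<in>?R. \<mu> \<le>o \<nu>"
    using exists_minim_Card_order[of ?R] by blast
  then have log: "is_log |topspace X| \<mu>"
    unfolding is_log_def by blast
  have \<mu>: "Well_order \<mu>" "|topspace X| \<le>o |Pow (Field \<mu>)|"
    using \<open>\<mu> \<in> ?R\<close> by (auto simp: ordLeq_ctwo_cexp_iff card_order_on_def)
  have "\<mu> \<le>o \<gamma>" if \<gamma>: "Well_order \<gamma>" "seeker_wins X \<gamma>" for \<gamma> :: "'a rel"
  proof -
    \<comment> \<open>The lower bound sees only the field of \<open>\<gamma>\<close>, so
      \<open>\<gamma>\<close> can be replaced by the cardinal of its field, which is no longer than
      \<open>\<gamma>\<close>.\<close>
    have "|Field \<gamma>| \<in> ?R"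
      using seeker_wins_card_le[OF \<gamma>]
      by (simp add: ordLeq_ctwo_cexp_iff Field_card_of card_of_card_order_on)
    then have "\<mu> \<le>o |Field \<gamma>|"
      using min by blast
    also have "|Field \<gamma>| \<le>o \<gamma>"
      using \<gamma>(1) by (rule card_of_least)
    finally show ?thesis .
  qed
  then have "is_ps X \<mu>"
    unfolding is_ps_def using \<mu> seeker_wins_log[OF assms] by blast
  then show ?thesis
    using log \<mu>(1) ordIso_reflexive by blast
qed

end
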